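(* A Farey point of a chain belongs to a critical curve transversal to the chain. That is, for every chain $\mathcal{L}_{i,j}$ and every Farey point $\zeta$ of $\mathcal{L}_{i,j}$ there is a chain $\mathcal{L}_{i',j'}$ of slope $i'\neq i$ such that $\zeta$ belongs to a critical curve on $\mathcal{L}_{i',j'}$ (so that $\zeta$ is not a Farey point of $\mathcal{L}_{i',j'}$).
   Context: Rotation and coding. For $(\theta,\rho)\in[0,1]^2$ let $\mathrm{g}:[0,1)\to[0,1)$, $x\mapsto\{x+\theta\}$ ($\{\cdot\}$ = fractional part), with the partition $I_a=[0,\rho)$, $I_b=[\rho,1)$, which codes each orbit by letters $a,b$. In phase space the values $\theta=1$, $\rho=1$ are represented by their fractional part $0$. Chains. For $(i,j)\in\mathbb{Z}^2$ with $0\leqslant j\leqslant i-1$ if $i>0$, $-1\leqslant j\leqslant 0$ if $i=0$, $i\leqslant j\leqslant -1$ if $i<0$, the chain with affine parameters $(i,j)$ is the segment $\mathcal{L}_{i,j}=\{(\theta,\rho)\in[0,1]^2: \rho=i\theta-j\}$. In particular $\mathcal{L}_{0,0}$ is the segment $\rho=0$ and $\mathcal{L}_{0,-1}$ the segment $\rho=1$. Critical words. The critical word at a point $(\theta,\rho)$ of $\mathcal{L}_{i,j}$ is: the empty word $\varepsilon$ if $\rho\in\{0,1\}$; if $\rho\neq0,1$ and $i>0$, the symbol sequence of the orbit starting at $0$ up to, but excluding, its first visit to $\rho$; if $\rho\neq 0,1$ and $i<0$, the symbol sequence of the orbit starting at $\rho$ up to, but excluding, its first visit to $0$. Critical curves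 and Farey points. A chain is partitioned into maximal connected subsets on which the critical word is constant; such a subset is called a critical curve if it has more than one point, and a Farey point if it is a single point. (In particular $\mathcal{L}_{0,0}$ and $\mathcal{L}_{0,-1}$ each consist of a single critical curve and have no Farey points.) *)

theory Defs
  imports "HOL-Analysis.Analysis"
begin

datatype letter = La | Lb

definition rot :: "real \<Rightarrow> real \<Rightarrow> real"
  where "rot \<theta> x = frac (x + \<theta>)"

(* For x in the phase space {0..<1}, the letter Lb means x \<in> {\<rho>..<1}. *)
definition letter_of :: "real \<Rightarrow> real \<Rightarrow> letter"
  where "letter_of \<rho> x = (if x \<in> {0..<\<rho>} then La else Lb)"

(* The word is meaningful when the orbit of x does visit y; in critical_word
   below this holds at every point of a chain. *)
definition word_until :: "real \<Rightarrow> real \<Rightarrow> real \<Rightarrow> real \<Rightarrow> letter list"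
  where "word_until \<theta> \<rho> x y =
    map (\<lambda>t. letter_of \<rho> ((rot \<theta> ^^ t) x)) [0..<(LEAST n. (rot \<theta> ^^ n) x = y)]"

definition chain_params :: "int \<Rightarrow> int \<Rightarrow> bool"
  where "chain_params i j \<longleftrightarrow>
    (i > 0 \<and> 0 \<le> j \<and> j \<le> i - 1) \<or>
    (i = 0 \<and> -1 \<le> j \<and> j \<le> 0) \<or>
    (i < 0 \<and> i \<le> j \<and> j \<le> -1)"

definition chain :: "int \<Rightarrow> int \<Rightarrow> (real \<times> real) set"
  where "chain i j =
    {(\<theta>, \<rho>). \<theta> \<in> {0..1} \<and> \<rho> \<in> {0..1} \<and> \<rho> = of_int i * \<theta> - of_int j}"

(* A chain with i = 0 lies in \<rho> = 0 or \<rho> = 1, so the last branch only matters for i < 0.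
   No argument j is needed: on a chain, j = i * \<theta> - \<rho>. *)
definition critical_word :: "int \<Rightarrow> real \<times> real \<Rightarrow> letter list"
  where "critical_word i = (\<lambda>(\<theta>, \<rho>).
    if \<rho> = 0 \<or> \<rho> = 1 then []
    else if i > 0 then word_until \<theta> \<rho> 0 \<rho>
    else word_until \<theta> \<rho> \<rho> 0)"

definition constant_word_piece :: "int \<Rightarrow> int \<Rightarrow> (real \<times> real) set \<Rightarrow> bool"
  where "constant_word_piece i j C \<longleftrightarrow>
    C \<noteq> {} \<and> C \<subseteq> chain i j \<and> connected C \<and> critical_word i constant_on C \<and>
    (\<forall>D. C \<subseteq> D \<and> D \<subseteq> chain i j \<and> connected D \<and> critical_word i constant_on D \<longrightarrow> D = C)"

definition critical_curve :: "int \<Rightarrow> int \<Rightarrow> (real \<times> real) set \<Rightarrow> bool"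
  where "critical_curve i j C \<longleftrightarrow>
    constant_word_piece i j C \<and> (\<exists>x\<in>C. \<exists>y\<in>C. x \<noteq> y)"

definition farey_point :: "int \<Rightarrow> int \<Rightarrow> real \<times> real \<Rightarrow> bool"
  where "farey_point i j \<zeta> \<longleftrightarrow> constant_word_piece i j {\<zeta>}"

end

theory Submission
  imports Defs
begin

text \<open>
  If \<open>\<rho>\<close> is \<open>0\<close> or \<open>1\<close>, the horizontal chain through the point is a single critical curve. Otherwise
  the critical word on the chain of slope \<open>i\<close> can change at \<open>\<theta>\<close> only if \<open>t \<theta>\<close> is an integer for some
  \<open>0 < t < \<bar>i\<bar>\<close>; hence a Farey point has a rational \<open>\<theta>\<close> with denominator \<open>q < \<bar>i\<bar>\<close>. Replacing
  \<open>i\<close> by \<open>i mod q\<close> gives a chain through the same point on which no such \<open>t\<close> exists, so the word is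
  locally constant there.
\<close>

section \<open>Fractional parts and orbits of the rotation\<close>

lemma frac_eq_frac_iff: "frac x = frac y \<longleftrightarrow> x - y \<in> \<int>" for x y :: real
proof
  assume "frac x = frac y"
  then have "x - y = of_int (\<lfloor>x\<rfloor> - \<lfloor>y\<rfloor>)" by (simp add: frac_def)
  then show "x - y \<in> \<int>" using Ints_of_int by metis
next
  assume "x - y \<in> \<int>"
  then obtain k :: int where "x = y + of_int k" by (metis Ints_cases diff_add_cancel add.commute)
  then show "frac x = frac y" by (simp add: frac_def)
qed

lemma rot_funpow:
  assumes "0 \<le> x" "x < 1"
  shows "(rot \<theta> ^^ n) x = frac (x + of_nat n * \<theta>)"
proof (induction n)
  case 0
  then show ?case using assms by (simp add: frac_eq)
next
  case (Suc n)
  have "frac (frac (x + of_nat n * \<theta>) + \<theta>) = frac (x + of_nat (Suc n) * \<theta>)"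
    unfolding frac_eq_frac_iff by (simp add: frac_def algebra_simps)
  then show ?case using Suc by (simp add: rot_def)
qed

text \<open>Since \<open>\<rho>\<close> is its own fractional part, a visit to \<open>\<rho>\<close>
  becomes an integrality condition, which can be compared with multiples of
  \<open>\<theta>\<close>.\<close>

lemma frac_eq_less_one_iff:
  fixes x :: real
  assumes "0 < \<rho>" "\<rho> < 1"
  shows "frac x = \<rho> \<longleftrightarrow> x - \<rho> \<in> \<int>"
  using frac_eq_frac_iff[of x \<rho>] assms by (simp add: frac_eq)

section \<open>Explicit critical words and their local constancy in \<open>\<theta>\<close>\<close>

lemma eventually_nonint:
  fixes f :: "real \<Rightarrow> real"
  assumes "isCont f x" "f x \<notin> \<int>"
  shows "eventually (\<lambda>y. f y \<notin> \<int>) (nhds x)"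
proof -
  have "open (- (\<int> :: real set))" by (simp add: closed_Ints open_Compl)
  then show ?thesis
    using assms unfolding isCont_def tendsto_at_iff_tendsto_nhds
    by (auto dest!: topological_tendstoD)
qed

text \<open>Away from the integers \<open>frac\<close> is continuous, so \<open>r - frac f\<close>
  is continuous at \<open>\<theta>\<close>. It is nonzero there and hence keeps its sign nearby. As
  \<open>frac\<close> is never negative, this sign alone decides the letter.\<close>

lemma eventually_letter_of_eq:
  fixes r f :: "real \<Rightarrow> real"
  assumes r: "isCont r \<theta>" and f: "isCont f \<theta>"
    and non: "f \<theta> \<notin> \<int>" and ne: "frac (f \<theta>) \<noteq> r \<theta>"
  shows "eventually (\<lambda>\<theta>'. letter_of (r \<theta>') (frac (f \<theta>')) = letter_of (r \<theta>) (frac (f \<theta>))) (nhds \<theta>)"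
proof -
  have "isCont (\<lambda>x. r x - frac (f x)) \<theta>"
    using isCont_diff[OF r isCont_o2[OF f continuous_frac[OF non]]] .
  then have t: "((\<lambda>x. r x - frac (f x)) \<longlongrightarrow> r \<theta> - frac (f \<theta>)) (nhds \<theta>)"
    unfolding isCont_def by (rule tendsto_at_iff_tendsto_nhds[THEN iffD1])
  show ?thesis
  proof (cases "frac (f \<theta>) < r \<theta>")
    case True
    show ?thesis using order_tendstoD(1)[OF t, of 0] True
      by (auto simp: letter_of_def elim!: eventually_mono)
  next
    case False
    then show ?thesis using order_tendstoD(2)[OF t, of 0] ne
      by (auto simp: letter_of_def elim!: eventually_mono)
  qed
qed

text \<open>The orbit of 0 is at \<open>\<rho>\<close> after \<open>i\<close> steps, because
  \<open>i * \<theta>\<close> and \<open>\<rho>\<close> differ by \<open>j\<close>. A visit at an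
  earlier time \<open>n\<close> would make \<open>(i - n) * \<theta>\<close> an integer. The word
  thus has length \<open>i\<close> for every such \<open>\<theta>\<close>.\<close>

lemma critical_word_pos:
  assumes i: "i > 0" and \<rho>: "\<rho> = of_int i * \<theta> - of_int j" "0 < \<rho>" "\<rho> < 1"
    and non: "\<And>t. 0 < t \<Longrightarrow> t < \<bar>i\<bar> \<Longrightarrow> of_int t * \<theta> \<notin> \<int>"
  shows "critical_word i (\<theta>, \<rho>) = map (\<lambda>t. letter_of \<rho> (frac (of_nat t * \<theta>))) [0..<nat i]"
proof -
  have *: "(rot \<theta> ^^ n) 0 = \<rho> \<longleftrightarrow> of_nat n * \<theta> - \<rho> \<in> \<int>" for n
    using rot_funpow[of 0 n \<theta>] frac_eq_less_one_iff[OF \<rho>(2,3)] by simp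
  have "(LEAST n. (rot \<theta> ^^ n) 0 = \<rho>) = nat i"
  proof (rule Least_equality)
    show "(rot \<theta> ^^ nat i) 0 = \<rho>" using i unfolding * by (simp add: \<rho>(1))
  next
    fix n assume "(rot \<theta> ^^ n) 0 = \<rho>"
    then have n: "of_nat n * \<theta> - \<rho> \<in> \<int>" by (simp add: *)
    show "nat i \<le> n"
    proof (rule ccontr)
      assume "\<not> nat i \<le> n"
      then have lt: "int n < i" by linarith
      have "of_int j - (of_nat n * \<theta> - \<rho>) \<in> \<int>" by (intro Ints_diff Ints_of_int n)
      moreover have "of_int j - (of_nat n * \<theta> - \<rho>) = of_int (i - int n) * \<theta>"
        using \<rho>(1) by (simp add: algebra_simps)
      ultimately have "of_int (i - int n) * \<theta> \<in> \<int>" by (simp only:)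
      \<comment> \<open>For \<open>n = 0\<close> the multiplier is \<open>i\<close> itself, outside
        the range of \<open>non\<close>. That case is excluded because \<open>\<rho>\<close> lies
        strictly between 0 and 1.\<close>
      with non[of "i - int n"] lt have "n = 0" by (cases n) auto
      then have "- \<rho> \<in> \<int>" using n by simp
      then have "\<rho> \<in> \<int>" by (simp add: minus_in_Ints_iff)
      then show False using \<rho>(2,3) by (auto elim!: Ints_cases)
    qed
  qed
  then show ?thesis using i \<rho>(2,3) rot_funpow[of 0 _ \<theta>]
    by (simp add: critical_word_def word_until_def)
qed

text \<open>The mirror image of \<open>critical_word_pos\<close>:
  \<open>\<rho> - i * \<theta>\<close> equals \<open>-j\<close>, so the orbit of
  \<open>\<rho>\<close> is at 0 after \<open>-i\<close> steps, and an earlier visit would make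
  \<open>(-i - n) * \<theta>\<close> an integer.\<close>

lemma critical_word_neg:
  assumes i: "i < 0" and \<rho>: "\<rho> = of_int i * \<theta> - of_int j" "0 < \<rho>" "\<rho> < 1"
    and non: "\<And>t. 0 < t \<Longrightarrow> t < \<bar>i\<bar> \<Longrightarrow> of_int t * \<theta> \<notin> \<int>"
  shows "critical_word i (\<theta>, \<rho>) = map (\<lambda>t. letter_of \<rho> (frac (\<rho> + of_nat t * \<theta>))) [0..<nat (-i)]"
proof -
  have *: "(rot \<theta> ^^ n) \<rho> = 0 \<longleftrightarrow> \<rho> + of_nat n * \<theta> \<in> \<int>" for n
    using rot_funpow[of \<rho> n \<theta>] \<rho>(2,3) by simp
  have "(LEAST n. (rot \<theta> ^^ n) \<rho> = 0) = nat (-i)"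
  proof (rule Least_equality)
    show "(rot \<theta> ^^ nat (-i)) \<rho> = 0" using i unfolding * by (simp add: \<rho>(1))
  next
    fix n assume "(rot \<theta> ^^ n) \<rho> = 0"
    then have n: "\<rho> + of_nat n * \<theta> \<in> \<int>" by (simp add: *)
    show "nat (-i) \<le> n"
    proof (rule ccontr)
      assume "\<not> nat (-i) \<le> n"
      then have lt: "int n < -i" by linarith
      have "of_int (- j) - (\<rho> + of_nat n * \<theta>) \<in> \<int>" by (intro Ints_diff Ints_of_int n)
      moreover have "of_int (- j) - (\<rho> + of_nat n * \<theta>) = of_int (- i - int n) * \<theta>"
        using \<rho>(1) by (simp add: algebra_simps)
      ultimately have "of_int (- i - int n) * \<theta> \<in> \<int>" by (simp only:)
      with non[of "- i - int n"] lt have "n = 0" by (cases n) auto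
      then have "\<rho> \<in> \<int>" using n by simp
      then show False using \<rho>(2,3) by (auto elim!: Ints_cases)
    qed
  qed
  then show ?thesis using i \<rho>(2,3) rot_funpow[of \<rho> _ \<theta>]
    by (simp add: critical_word_def word_until_def)
qed

text \<open>The length of the word is \<open>\<bar>i\<bar>\<close> near \<open>\<theta>\<close>, so
  only finitely many letters have to be controlled. A letter can change only where its orbit point
  meets 0 or \<open>\<rho>\<close>, and after time 0 both events make a multiple
  \<open>t * \<theta>\<close> with \<open>0 < t < \<bar>i\<bar>\<close> an integer.\<close>

lemma eventually_critical_word_eq:
  fixes \<theta> :: real
  assumes i: "i \<noteq> 0" and \<rho>: "0 < of_int i * \<theta> - of_int j" "of_int i * \<theta> - of_int j < 1"
    and non: "\<And>t. 0 < t \<Longrightarrow> t < \<bar>i\<bar> \<Longrightarrow> of_int t * \<theta> \<notin> \<int>"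
  shows "eventually (\<lambda>\<theta>'. critical_word i (\<theta>', of_int i * \<theta>' - of_int j)
           = critical_word i (\<theta>, of_int i * \<theta> - of_int j)) (nhds \<theta>)"
proof -
  define r where "r \<theta> = of_int i * \<theta> - of_int j" for \<theta> :: real
  have r_cont: "isCont r x" for x unfolding r_def by (intro continuous_intros)
  have r_tendsto: "(r \<longlongrightarrow> r \<theta>) (nhds \<theta>)"
    using r_cont unfolding isCont_def by (intro tendsto_at_iff_tendsto_nhds[THEN iffD1])
  have ev1: "eventually (\<lambda>\<theta>'. 0 < r \<theta>') (nhds \<theta>)" "eventually (\<lambda>\<theta>'. r \<theta>' < 1) (nhds \<theta>)"
    using \<rho> by (auto intro!: order_tendstoD[OF r_tendsto] simp: r_def[of \<theta>])
  \<comment> \<open>Finitely many open conditions hold on a common neighbourhood, so the explicit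
    form of the word is available there too.\<close>
  have "eventually (\<lambda>\<theta>'. \<forall>t\<in>{0<..<\<bar>i\<bar>}. of_int t * \<theta>' \<notin> \<int>) (nhds \<theta>)"
    using non by (intro eventually_ball_finite ballI eventually_nonint continuous_intros) auto
  then have ev2: "eventually (\<lambda>\<theta>'. \<forall>t. 0 < t \<longrightarrow> t < \<bar>i\<bar> \<longrightarrow> of_int t * \<theta>' \<notin> \<int>) (nhds \<theta>)"
    by eventually_elim auto
  have r01: "0 < r \<theta>" "r \<theta> < 1" using \<rho> by (auto simp: r_def)
  have frac_ne: "frac x \<noteq> r \<theta>" if "x - r \<theta> \<notin> \<int>" for x
    using frac_eq_less_one_iff[OF r01] that by blast
  show ?thesis
  proof (cases "i > 0")
    case True
    have letters: "eventually (\<lambda>\<theta>'. letter_of (r \<theta>') (frac (of_nat t * \<theta>'))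
        = letter_of (r \<theta>) (frac (of_nat t * \<theta>))) (nhds \<theta>)" if t: "t < nat i" for t
    proof (cases "t = 0")
      case True
      \<comment> \<open>The orbit starts at the integer 0, where \<open>frac\<close> jumps. The
        letter is \<open>La\<close> directly, as long as \<open>r\<close> stays positive.\<close>
      with ev1(1) r01 show ?thesis by (auto simp: letter_of_def elim!: eventually_mono)
    next
      case False
      \<comment> \<open>The multiplier \<open>i - t\<close> rules out a visit to
        \<open>\<rho>\<close> at time \<open>t\<close>, and the multiplier \<open>t\<close> rules
        out a return to 0.\<close>
      have "of_int (i - int t) * \<theta> \<notin> \<int>" using False t True by (intro non) auto
      moreover have "of_int (i - int t) * \<theta> = of_int j - (of_nat t * \<theta> - r \<theta>)"
        by (simp add: r_def algebra_simps)
      ultimately have "of_nat t * \<theta> - r \<theta> \<notin> \<int>" by (metis Ints_diff Ints_of_int)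
      then have "frac (of_nat t * \<theta>) \<noteq> r \<theta>" by (rule frac_ne)
      moreover have "of_nat t * \<theta> \<notin> \<int>" using non[of "int t"] False t True by simp
      ultimately show ?thesis
        by (intro eventually_letter_of_eq r_cont continuous_intros)
    qed
    have "eventually (\<lambda>\<theta>'. \<forall>t\<in>{..<nat i}. letter_of (r \<theta>') (frac (of_nat t * \<theta>'))
        = letter_of (r \<theta>) (frac (of_nat t * \<theta>))) (nhds \<theta>)"
      using letters by (intro eventually_ball_finite) auto
    with ev1 ev2 show ?thesis unfolding r_def[symmetric]
    proof eventually_elim
      case (elim \<theta>')
      then have "critical_word i (\<theta>', r \<theta>') = map (\<lambda>t. letter_of (r \<theta>') (frac (of_nat t * \<theta>'))) [0..<nat i]"
        by (intro critical_word_pos[OF True, where j = j]) (auto simp: r_def)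
      moreover have "critical_word i (\<theta>, r \<theta>) = map (\<lambda>t. letter_of (r \<theta>) (frac (of_nat t * \<theta>))) [0..<nat i]"
        using r01 non by (intro critical_word_pos[OF True, where j = j]) (auto simp: r_def)
      ultimately show ?case using elim by simp
    qed
  next
    case False
    with i have neg: "i < 0" by simp
    have letters: "eventually (\<lambda>\<theta>'. letter_of (r \<theta>') (frac (r \<theta>' + of_nat t * \<theta>'))
        = letter_of (r \<theta>) (frac (r \<theta> + of_nat t * \<theta>))) (nhds \<theta>)" if t: "t < nat (-i)" for t
    proof (cases "t = 0")
      case True
      \<comment> \<open>The starting point is the moving endpoint \<open>\<rho>\<close> itself, so
        there is no gap to preserve. It belongs to the right-hand interval for every
        \<open>\<theta>'\<close> nearby.\<close>
      have "letter_of x (frac x) = Lb" if "0 < x" "x < 1" for x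
        using that by (simp add: letter_of_def frac_eq)
      with ev1 r01 True show ?thesis by (auto elim: eventually_elim2)
    next
      case False
      \<comment> \<open>The roles are exchanged: the multiplier \<open>-i - t\<close> rules out a
        visit to 0, and \<open>t\<close> rules out a return to \<open>\<rho>\<close>.\<close>
      have "of_int (- i - int t) * \<theta> \<notin> \<int>" using False t neg by (intro non) auto
      moreover have "of_int (- i - int t) * \<theta> = of_int (- j) - (r \<theta> + of_nat t * \<theta>)"
        by (simp add: r_def algebra_simps)
      ultimately have "r \<theta> + of_nat t * \<theta> \<notin> \<int>" by (metis Ints_diff Ints_of_int)
      moreover have "frac (r \<theta> + of_nat t * \<theta>) \<noteq> r \<theta>"
        using non[of "int t"] False t neg by (intro frac_ne) auto
      ultimately show ?thesis
        by (intro eventually_letter_of_eq r_cont continuous_intros)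
    qed
    have "eventually (\<lambda>\<theta>'. \<forall>t\<in>{..<nat (-i)}. letter_of (r \<theta>') (frac (r \<theta>' + of_nat t * \<theta>'))
        = letter_of (r \<theta>) (frac (r \<theta> + of_nat t * \<theta>))) (nhds \<theta>)"
      using letters by (intro eventually_ball_finite) auto
    with ev1 ev2 show ?thesis unfolding r_def[symmetric]
    proof eventually_elim
      case (elim \<theta>')
      then have "critical_word i (\<theta>', r \<theta>') = map (\<lambda>t. letter_of (r \<theta>') (frac (r \<theta>' + of_nat t * \<theta>'))) [0..<nat (-i)]"
        by (intro critical_word_neg[OF neg, where j = j]) (auto simp: r_def)
      moreover have "critical_word i (\<theta>, r \<theta>) = map (\<lambda>t. letter_of (r \<theta>) (frac (r \<theta> + of_nat t * \<theta>))) [0..<nat (-i)]"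
        using r01 non by (intro critical_word_neg[OF neg, where j = j]) (auto simp: r_def)
      ultimately show ?case using elim by simp
    qed
  qed
qed

section \<open>From local constancy to critical curves\<close>

lemma connected_chain_image:
  fixes S :: "real set"
  assumes "connected S"
  shows "connected ((\<lambda>\<theta>. (\<theta>, of_int i * \<theta> - of_int j :: real)) ` S)"
  by (intro connected_continuous_image continuous_intros assms)

text \<open>The component of \<open>z\<close> in the level set of the critical word contains every
  connected set through \<open>z\<close> with constant word, so it is maximal. Since
  \<open>E\<close> has a second point, \<open>{z}\<close> is not maximal.\<close>

lemma critical_curve_through:
  assumes E: "E \<subseteq> chain i j" "connected E" "critical_word i constant_on E"
    and pts: "z \<in> E" "y \<in> E" "y \<noteq> z"
  shows "(\<exists>C. critical_curve i j C \<and> z \<in> C) \<and> \<not> farey_point i j z"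
proof -
  let ?L = "{x \<in> chain i j. critical_word i x = critical_word i z}"
  define C where "C = connected_component_set ?L z"
  have const: "critical_word i x = critical_word i z"
    if "x \<in> D" "z \<in> D" "critical_word i constant_on D" for x D
    using that unfolding constant_on_def by metis
  have max: "D \<subseteq> C" if "z \<in> D" "D \<subseteq> chain i j" "connected D" "critical_word i constant_on D" for D
  proof -
    have "D \<subseteq> ?L" using that(2) const[OF _ that(1,4)] by blast
    then show ?thesis unfolding C_def using that(1,3) by (intro connected_component_maximal)
  qed
  have EC: "E \<subseteq> C" using E pts by (intro max)
  have CL: "C \<subseteq> ?L" unfolding C_def by (rule connected_component_subset)
  have "constant_word_piece i j C"
    unfolding constant_word_piece_def
  proof (intro conjI allI impI)
    show "critical_word i constant_on C" using CL unfolding constant_on_def by blast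
    show "connected C" unfolding C_def by simp
    fix D assume "C \<subseteq> D \<and> D \<subseteq> chain i j \<and> connected D \<and> critical_word i constant_on D"
    then show "D = C" using max[of D] EC pts by blast
  qed (use CL EC pts in auto)
  moreover have "\<not> farey_point i j z"
    using E pts unfolding farey_point_def constant_word_piece_def by blast
  ultimately show ?thesis using EC pts unfolding critical_curve_def by blast
qed

text \<open>Near \<open>\<theta>\<close> the line stays in the unit square and the word is constant,
  so the image of a small interval serves as \<open>E\<close> in
  \<open>critical_curve_through\<close>.\<close>

lemma critical_curve_through_interior:
  fixes \<theta> :: real
  assumes "i \<noteq> 0" and \<rho>: "0 < of_int i * \<theta> - of_int j" "of_int i * \<theta> - of_int j < 1"
    and \<theta>: "0 < \<theta>" "\<theta> < 1"
    and "\<And>t. 0 < t \<Longrightarrow> t < \<bar>i\<bar> \<Longrightarrow> of_int t * \<theta> \<notin> \<int>"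
  shows "(\<exists>C. critical_curve i j C \<and> (\<theta>, of_int i * \<theta> - of_int j) \<in> C) \<and>
           \<not> farey_point i j (\<theta>, of_int i * \<theta> - of_int j)"
proof -
  let ?p = "\<lambda>\<theta>. (\<theta>, of_int i * \<theta> - of_int j :: real)"
  have t: "((\<lambda>\<theta>. of_int i * \<theta> - of_int j) \<longlongrightarrow> of_int i * \<theta> - of_int j) (nhds \<theta>)"
    by (intro tendsto_intros filterlim_ident)
  have "eventually (\<lambda>\<theta>'. 0 < \<theta>' \<and> \<theta>' < 1) (nhds \<theta>)"
    using eventually_nhds_in_open[of "{0<..<1}" \<theta>] \<theta> by simp
  then have "eventually (\<lambda>\<theta>'. ?p \<theta>' \<in> chain i j) (nhds \<theta>)"
    using order_tendstoD(1)[OF t \<rho>(1)] order_tendstoD(2)[OF t \<rho>(2)]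
    by eventually_elim (simp add: chain_def)
  then have "eventually (\<lambda>\<theta>'. ?p \<theta>' \<in> chain i j \<and> critical_word i (?p \<theta>') = critical_word i (?p \<theta>)) (nhds \<theta>)"
    using eventually_critical_word_eq[OF assms(1) \<rho> assms(6)] by (rule eventually_conj)
  then obtain e where e: "e > 0"
    "\<And>\<theta>'. dist \<theta>' \<theta> < e \<Longrightarrow> ?p \<theta>' \<in> chain i j \<and> critical_word i (?p \<theta>') = critical_word i (?p \<theta>)"
    unfolding eventually_nhds_metric by blast
  show ?thesis
  proof (rule critical_curve_through)
    show "?p ` ball \<theta> e \<subseteq> chain i j" using e(2) by (auto simp: dist_commute)
    show "connected (?p ` ball \<theta> e)" by (intro connected_chain_image connected_ball)
    show "critical_word i constant_on ?p ` ball \<theta> e"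
      unfolding constant_on_def using e(2) by (auto simp: dist_commute)
    show "?p \<theta> \<in> ?p ` ball \<theta> e" using e(1) by (intro imageI) simp
    show "?p (\<theta> + e / 2) \<in> ?p ` ball \<theta> e" using e(1) by (intro imageI) (simp add: dist_real_def)
    show "?p (\<theta> + e / 2) \<noteq> ?p \<theta>" using e(1) by simp
  qed
qed

text \<open>On \<open>\<rho> = 0\<close> and \<open>\<rho> = 1\<close> the word is empty by
  definition, so the whole segment can be taken as \<open>E\<close>.\<close>

lemma critical_curve_horizontal:
  assumes "j \<in> {-1, 0}" "\<theta> \<in> {0..1}"
  shows "(\<exists>C. critical_curve 0 j C \<and> (\<theta>, - of_int j) \<in> C) \<and> \<not> farey_point 0 j (\<theta>, - of_int j)"
proof (rule critical_curve_through)
  have eq: "chain 0 j = (\<lambda>\<theta>. (\<theta>, of_int 0 * \<theta> - of_int j)) ` {0..1}"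
    using assms(1) by (auto simp: chain_def)
  show "connected (chain 0 j)" unfolding eq by (intro connected_chain_image connected_Icc)
  show "critical_word 0 constant_on chain 0 j"
    unfolding constant_on_def
  proof (intro exI ballI)
    fix x assume "x \<in> chain 0 j"
    then show "critical_word 0 x = []"
      using assms(1) by (cases x) (auto simp: chain_def critical_word_def)
  qed
  show "(\<theta>, - of_int j) \<in> chain 0 j" using assms by (auto simp: chain_def)
  show "(if \<theta> = 0 then 1 else 0, - of_int j) \<in> chain 0 j" using assms by (auto simp: chain_def)
qed auto

theorem corollary4:
  fixes i j :: int and \<zeta> :: "real \<times> real"
  assumes "chain_params i j"
    and "farey_point i j \<zeta>"
  shows "\<exists>i' j'. chain_params i' j' \<and> i' \<noteq> i \<and>
           (\<exists>C. critical_curve i' j' C \<and> \<zeta> \<in> C) \<and>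
           \<not> farey_point i' j' \<zeta>"
proof -
  obtain \<theta> \<rho> where \<zeta>: "\<zeta> = (\<theta>, \<rho>)" by (cases \<zeta>)
  have "\<zeta> \<in> chain i j"
    using assms(2) unfolding farey_point_def constant_word_piece_def by simp
  then have \<theta>: "0 \<le> \<theta>" "\<theta> \<le> 1" and \<rho>: "0 \<le> \<rho>" "\<rho> \<le> 1" and \<rho>_eq: "\<rho> = of_int i * \<theta> - of_int j"
    by (auto simp: \<zeta> chain_def)
  show ?thesis
  proof (cases "\<rho> \<in> \<int>")
    case True
    then obtain k :: int where k: "\<rho> = of_int k" by (auto elim: Ints_cases)
    with \<rho> have k01: "- k \<in> {-1, 0}" by auto
    have curve: "(\<exists>C. critical_curve 0 (-k) C \<and> \<zeta> \<in> C) \<and> \<not> farey_point 0 (-k) \<zeta>"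
      using critical_curve_horizontal[OF k01, of \<theta>] \<theta> by (simp add: \<zeta> k)
    moreover have "i \<noteq> 0"
    \<comment> \<open>With slope 0 the given chain would be this very segment, on which
      \<open>\<zeta>\<close> is not a Farey point.\<close>
    proof
      assume "i = 0"
      then have "j = - k" using \<rho>_eq k by simp
      with \<open>i = 0\<close> curve assms(2) show False by simp
    qed
    moreover have "chain_params 0 (-k)" using k01 by (auto simp: chain_params_def)
    ultimately show ?thesis by metis
  next
    case False
    have "\<rho> \<noteq> 0" "\<rho> \<noteq> 1" using False by auto
    with \<rho> have \<rho>01: "0 < \<rho>" "\<rho> < 1" by auto
    have \<theta>_nonint: "\<theta> \<notin> \<int>"
    proof
      assume "\<theta> \<in> \<int>"
      then have "of_int i * \<theta> - of_int j \<in> \<int>" by (intro Ints_diff Ints_mult) auto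
      with False \<rho>_eq show False by simp
    qed
    then have "\<theta> \<noteq> 0" "\<theta> \<noteq> 1" by auto
    with \<theta> have \<theta>01: "0 < \<theta>" "\<theta> < 1" by auto
    have "i \<noteq> 0" using False \<rho>_eq by auto
    \<comment> \<open>Without such a \<open>t\<close> the word would be locally constant at
      \<open>\<zeta>\<close> along the given chain, against the Farey hypothesis.\<close>
    then obtain t where t: "0 < t" "t < \<bar>i\<bar>" "of_int t * \<theta> \<in> \<int>"
      using critical_curve_through_interior[of i \<theta> j] \<rho>01 \<theta>01 assms(2) \<rho>_eq \<zeta> by metis
    define P where "P n \<longleftrightarrow> 0 < n \<and> of_nat n * \<theta> \<in> \<int>" for n :: nat
    \<comment> \<open>\<open>q\<close> is the denominator of \<open>\<theta>\<close> in lowest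
      terms.\<close>
    define q where "q = (LEAST n. P n)"
    have Pt: "P (nat t)" using t by (simp add: P_def)
    then have "P q" unfolding q_def by (rule LeastI)
    then have q: "0 < q" "of_nat q * \<theta> \<in> \<int>" by (auto simp: P_def)
    have "q \<le> nat t" unfolding q_def using Pt by (rule Least_le)
    with t have q_less: "int q < \<bar>i\<bar>" by linarith
    \<comment> \<open>Changing the slope by a multiple of \<open>q\<close> changes
      \<open>i * \<theta>\<close> by an integer, which \<open>j'\<close> absorbs. The residue
      satisfies \<open>0 \<le> i' < q < \<bar>i\<bar>\<close>, so it differs from \<open>i\<close>
      and its smaller multipliers lie below the denominator.\<close>
    define i' where "i' = i mod int q"
    have i'_bounds: "0 \<le> i'" "i' < int q" using q(1) by (auto simp: i'_def)
    have min: "of_int s * \<theta> \<notin> \<int>" if "0 < s" "s < i'" for s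
    proof -
      have "nat s < q" using that i'_bounds by linarith
      then have "\<not> P (nat s)" unfolding q_def by (rule not_less_Least)
      with that show ?thesis by (simp add: P_def)
    qed
    have "i' = i - int q * (i div int q)" by (simp add: i'_def minus_mult_div_eq_mod)
    then have "of_int i' = (of_int i - of_nat q * of_int (i div int q) :: real)" by simp
    then have "of_int i' * \<theta> - \<rho> = of_int j - of_int (i div int q) * (of_nat q * \<theta>)"
      unfolding \<rho>_eq by (simp only:) (simp add: algebra_simps)
    also have "\<dots> \<in> \<int>" by (intro Ints_diff Ints_of_int Ints_mult[OF Ints_of_int q(2)])
    finally obtain j' :: int where "of_int i' * \<theta> - \<rho> = of_int j'" by (auto elim: Ints_cases)
    then have j': "\<rho> = of_int i' * \<theta> - of_int j'" by simp
    \<comment> \<open>A zero residue would make \<open>\<rho>\<close> an integer.\<close>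
    have "i' \<noteq> 0" using j' False by auto
    with i'_bounds have i'_pos: "0 < i'" by simp
    have "of_int i' * \<theta> < of_int i'" "0 < of_int i' * \<theta>" using i'_pos \<theta>01 by auto
    \<comment> \<open>For the integer \<open>j'\<close> these strict bounds amount to
      \<open>0 \<le> j' \<le> i' - 1\<close>.\<close>
    then have "of_int j' < (of_int i' :: real)" "(-1 :: real) < of_int j'" using j' \<rho>01 by linarith+
    then have "chain_params i' j'" using i'_pos by (auto simp: chain_params_def)
    moreover have "i' \<noteq> i" using i'_bounds q_less by linarith
    moreover have "(\<exists>C. critical_curve i' j' C \<and> \<zeta> \<in> C) \<and> \<not> farey_point i' j' \<zeta>"
      using critical_curve_through_interior[of i' \<theta> j'] i'_pos \<rho>01 \<theta>01 min by (simp add: \<zeta> j')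
    ultimately show ?thesis by blast
  qed
qed

end
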